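(* Let $X$ be a real Banach space and $\tau$ an infinite cardinal. The following are equivalent: (1) $X$ contains a complemented copy of $c_0(\tau)$. (2) There exist a family $(x_i)_{i\in\tau}$ in $X$ equivalent to the unit-vector basis of $c_0(\tau)$ and a weak$^*$-null family $(x_i^* )_{i\in\tau}$ in $X^*$ such that $x_i^*(x_j)=\delta_{ij}$ for all $i,j\in\tau$. (3) There exist a family $(x_i)_{i\in\tau}$ in $X$ equivalent to the unit-vector basis of $c_0(\tau)$ and a weak$^*$-null family $(x_i^* )_{i\in\tau}$ in $X^*$ such that $\inf_{i\in\tau}|x_i^*(x_i)|>0$.
   Context: All Banach spaces are real; $X^*$ is the dual of $X$; $\delta_{ij}$ is the Kronecker delta. $c_0(\tau)$ is the Banach space of all maps $f:\tau\to\mathbb{R}$ such that for each $\varepsilon>0$ the set $\{i\in\tau : |f(i)|\ge\varepsilon\}$ is finite, with the supremum norm. Its unit-vector basis is the family $(e_i)_{i\in\tau}$ with $e_i(i)=1$ and $e_i(j)=0$ for $j\ne i$. A family $(x_i)_{i\in\tau}$ in $X$ is equivalent to the unit-vector basis of $c_0(\tau)$ if there is a bounded linear operator $S:c_0(\tau)\to X$ that is an isomorphism (linear homeomorphism) onto its image and satisfies $S(e_i)=x_i$ for every $i\in\tau$. A family $(x_i^* )_{i\in\tau}$ in $X^*$ is weak$^*$-null if $(x_i^*(x))_{i\in\tau}\in c_0(\tau)$ for every $x\in X$. $X$ contains a complemented copy of $c_0(\tau)$ if $c_0(\tau)$ is isomorphic to a closed subspace of $X$ which is the range of a bounded linear projection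 on $X$. *)

theory Defs
  imports "HOL-Analysis.Analysis"
begin

definition c0_fun :: "('i \<Rightarrow> real) \<Rightarrow> bool" where
  "c0_fun f \<longleftrightarrow> (\<forall>\<epsilon>>0. finite {i. \<bar>f i\<bar> \<ge> \<epsilon>})"

lemma c0_fun_zero: "c0_fun (\<lambda>i. 0)"
  by (simp add: c0_fun_def)

lemma c0_fun_add:
  assumes "c0_fun f" "c0_fun g"
  shows "c0_fun (\<lambda>i. f i + g i)"
  unfolding c0_fun_def
proof (intro allI impI)
  fix \<epsilon> :: real
  assume "\<epsilon> > 0"
  then have "\<epsilon> / 2 > 0" by simp
  then have "finite ({i. \<bar>f i\<bar> \<ge> \<epsilon> / 2} \<union> {i. \<bar>g i\<bar> \<ge> \<epsilon> / 2})"
    using assms unfolding c0_fun_def by blast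
  moreover have "{i. \<bar>f i + g i\<bar> \<ge> \<epsilon>} \<subseteq> {i. \<bar>f i\<bar> \<ge> \<epsilon> / 2} \<union> {i. \<bar>g i\<bar> \<ge> \<epsilon> / 2}"
    by (auto simp: abs_if split: if_splits)
  ultimately show "finite {i. \<bar>f i + g i\<bar> \<ge> \<epsilon>}"
    by (rule rev_finite_subset)
qed

lemma c0_fun_scale:
  assumes "c0_fun f"
  shows "c0_fun (\<lambda>i. r * f i)"
proof (cases "r = 0")
  case False
  have "finite {i. \<bar>r * f i\<bar> \<ge> \<epsilon>}" if "\<epsilon> > 0" for \<epsilon>
  proof -
    have "{i. \<bar>r * f i\<bar> \<ge> \<epsilon>} = {i. \<bar>f i\<bar> \<ge> \<epsilon> / \<bar>r\<bar>}"
      using False by (auto simp: abs_mult field_simps)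
    then show ?thesis
      using assms that False by (simp add: c0_fun_def)
  qed
  then show ?thesis by (simp add: c0_fun_def)
qed (simp add: c0_fun_zero)

lemma c0_fun_uminus:
  assumes "c0_fun f"
  shows "c0_fun (\<lambda>i. - f i)"
  using assms by (simp add: c0_fun_def)

lemma c0_fun_diff:
  assumes "c0_fun f" "c0_fun g"
  shows "c0_fun (\<lambda>i. f i - g i)"
  using c0_fun_add[OF assms(1) c0_fun_uminus[OF assms(2)]] by simp

lemma c0_fun_unit: "c0_fun (\<lambda>j. if j = i then 1 else 0)"
  unfolding c0_fun_def
proof (intro allI impI)
  fix \<epsilon> :: real
  assume "\<epsilon> > 0"
  then have "{j. \<bar>if j = i then 1 else 0 :: real\<bar> \<ge> \<epsilon>} \<subseteq> {i}"
    by auto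
  then show "finite {j. \<bar>if j = i then 1 else 0 :: real\<bar> \<ge> \<epsilon>}"
    by (rule finite_subset) simp
qed

lemma c0_fun_bdd_above:
  assumes "c0_fun f"
  shows "bdd_above (range (\<lambda>i. \<bar>f i\<bar>))"
proof -
  have "finite {i. \<bar>f i\<bar> \<ge> 1}"
    using assms by (simp add: c0_fun_def)
  then have "bdd_above ((\<lambda>i. \<bar>f i\<bar>) ` {i. \<bar>f i\<bar> \<ge> 1})"
    by simp
  moreover have "bdd_above ((\<lambda>i. \<bar>f i\<bar>) ` {i. \<not> \<bar>f i\<bar> \<ge> 1})"
    by (rule bdd_aboveI[of _ 1]) auto
  ultimately have "bdd_above ((\<lambda>i. \<bar>f i\<bar>) ` {i. \<bar>f i\<bar> \<ge> 1} \<union> (\<lambda>i. \<bar>f i\<bar>) ` {i. \<not> \<bar>f i\<bar> \<ge> 1})"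
    by simp
  moreover have "range (\<lambda>i. \<bar>f i\<bar>) = (\<lambda>i. \<bar>f i\<bar>) ` {i. \<bar>f i\<bar> \<ge> 1} \<union> (\<lambda>i. \<bar>f i\<bar>) ` {i. \<not> \<bar>f i\<bar> \<ge> 1}"
    by auto
  ultimately show ?thesis by simp
qed

text \<open>The space \<open>c\<^sub>0(\<tau>)\<close>, with an index type \<open>'i\<close> of cardinality \<open>\<tau>\<close> in the place of \<open>\<tau>\<close>.\<close>

typedef 'i c0 = "{f :: 'i \<Rightarrow> real. c0_fun f}"
  morphisms c0_apply Abs_c0
  using c0_fun_zero by auto

setup_lifting type_definition_c0

lemma c0_fun_apply: "c0_fun (c0_apply f)"
  using c0_apply by auto

lemma c0_eqI: "(\<And>i. c0_apply f i = c0_apply g i) \<Longrightarrow> f = g"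
  by (simp add: c0_apply_inject[symmetric] fun_eq_iff)

lift_definition c0_unit :: "'i \<Rightarrow> 'i c0" is "\<lambda>i j. if j = i then 1 else 0"
  by (rule c0_fun_unit)

instantiation c0 :: (type) real_vector
begin

lift_definition zero_c0 :: "'a c0" is "\<lambda>i. 0" by (rule c0_fun_zero)
lift_definition plus_c0 :: "'a c0 \<Rightarrow> 'a c0 \<Rightarrow> 'a c0" is "\<lambda>f g i. f i + g i" by (rule c0_fun_add)
lift_definition uminus_c0 :: "'a c0 \<Rightarrow> 'a c0" is "\<lambda>f i. - f i" by (rule c0_fun_uminus)
lift_definition minus_c0 :: "'a c0 \<Rightarrow> 'a c0 \<Rightarrow> 'a c0" is "\<lambda>f g i. f i - g i" by (rule c0_fun_diff)
lift_definition scaleR_c0 :: "real \<Rightarrow> 'a c0 \<Rightarrow> 'a c0" is "\<lambda>r f i. r * f i" by (rule c0_fun_scale)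

instance
  by standard (transfer, simp add: fun_eq_iff algebra_simps)+

end

lemmas c0_apply_simps [simp] =
  zero_c0.rep_eq plus_c0.rep_eq uminus_c0.rep_eq minus_c0.rep_eq scaleR_c0.rep_eq c0_unit.rep_eq

instantiation c0 :: (type) real_normed_vector
begin

definition norm_c0 :: "'a c0 \<Rightarrow> real" where
  "norm_c0 f = (SUP i. \<bar>c0_apply f i\<bar>)"

definition dist_c0 :: "'a c0 \<Rightarrow> 'a c0 \<Rightarrow> real" where
  "dist_c0 f g = norm (f - g)"

definition sgn_c0 :: "'a c0 \<Rightarrow> 'a c0" where
  "sgn_c0 f = f /\<^sub>R norm f"

definition uniformity_c0 :: "('a c0 \<times> 'a c0) filter" where
  "uniformity_c0 = (INF e\<in>{0 <..}. principal {(f, g). dist f g < e})"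

definition open_c0 :: "'a c0 set \<Rightarrow> bool" where
  "open_c0 U \<longleftrightarrow> (\<forall>f\<in>U. eventually (\<lambda>(f', g). f' = f \<longrightarrow> g \<in> U) uniformity)"

instance
proof
  have le_norm: "\<bar>c0_apply f i\<bar> \<le> norm f" for f :: "'a c0" and i
    unfolding norm_c0_def by (intro cSUP_upper c0_fun_bdd_above c0_fun_apply) simp
  have norm_le: "norm f \<le> B" if "\<And>i. \<bar>c0_apply f i\<bar> \<le> B" for f :: "'a c0" and B
    unfolding norm_c0_def by (intro cSUP_least that) simp
  fix f g :: "'a c0" and r :: real
  show "norm f = 0 \<longleftrightarrow> f = 0"
  proof
    assume "norm f = 0"
    then have "c0_apply f i = 0" for i using le_norm[of f i] by simp
    then show "f = 0" by (intro c0_eqI) simp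
  qed (simp add: norm_c0_def)
  show "norm (f + g) \<le> norm f + norm g"
  proof (rule norm_le)
    fix i
    show "\<bar>c0_apply (f + g) i\<bar> \<le> norm f + norm g"
      using le_norm[of f i] le_norm[of g i] by simp
  qed
  show "norm (r *\<^sub>R f) = \<bar>r\<bar> * norm f"
  proof (rule antisym)
    show *: "norm (r *\<^sub>R f) \<le> \<bar>r\<bar> * norm f" for r and f :: "'a c0"
      by (rule norm_le) (simp add: abs_mult mult_left_mono le_norm)
    show "\<bar>r\<bar> * norm f \<le> norm (r *\<^sub>R f)"
    proof (cases "r = 0")
      case False
      then have "norm f \<le> \<bar>inverse r\<bar> * norm (r *\<^sub>R f)"
        using *[of "inverse r" "r *\<^sub>R f"] by simp
      then show ?thesis using False by (simp add: field_simps)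
    qed (simp add: norm_c0_def)
  qed
qed (simp_all add: dist_c0_def sgn_c0_def uniformity_c0_def open_c0_def)

end

lemma c0_apply_le_norm: "\<bar>c0_apply f i\<bar> \<le> norm f"
  unfolding norm_c0_def by (intro cSUP_upper c0_fun_bdd_above c0_fun_apply) simp

lemma c0_norm_le: "(\<And>i. \<bar>c0_apply f i\<bar> \<le> B) \<Longrightarrow> norm f \<le> B"
  unfolding norm_c0_def by (intro cSUP_least) auto

instance c0 :: (type) banach
proof
  fix X :: "nat \<Rightarrow> 'a c0"
  assume X: "Cauchy X"
  have "Cauchy (\<lambda>n. c0_apply (X n) i)" for i
  proof (rule CauchyI)
    fix e :: real
    assume "e > 0"
    then obtain N where N: "\<forall>m\<ge>N. \<forall>n\<ge>N. norm (X m - X n) < e"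
      using CauchyD[OF X] by blast
    have "norm (c0_apply (X m) i - c0_apply (X n) i) \<le> norm (X m - X n)" for m n
      using c0_apply_le_norm[of "X m - X n" i] by simp
    then show "\<exists>M. \<forall>m\<ge>M. \<forall>n\<ge>M. norm (c0_apply (X m) i - c0_apply (X n) i) < e"
      using N by (meson le_less_trans)
  qed
  then have "\<exists>l. (\<lambda>n. c0_apply (X n) i) \<longlonglongrightarrow> l" for i
    using Cauchy_convergent_iff convergent_def by blast
  then obtain L where L: "\<And>i. (\<lambda>n. c0_apply (X n) i) \<longlonglongrightarrow> L i"
    by metis
  have unif: "\<exists>N. \<forall>n\<ge>N. \<forall>i. \<bar>c0_apply (X n) i - L i\<bar> \<le> e" if "e > 0" for e
  proof -
    obtain N where N: "\<forall>m\<ge>N. \<forall>n\<ge>N. norm (X m - X n) < e"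
      using CauchyD[OF X \<open>e > 0\<close>] by blast
    have "\<bar>c0_apply (X n) i - L i\<bar> \<le> e" if "n \<ge> N" for n i
    proof (rule LIMSEQ_le_const2)
      show "(\<lambda>m. \<bar>c0_apply (X n) i - c0_apply (X m) i\<bar>) \<longlonglongrightarrow> \<bar>c0_apply (X n) i - L i\<bar>"
        by (intro tendsto_intros L)
      have "\<bar>c0_apply (X n) i - c0_apply (X m) i\<bar> \<le> e" if "m \<ge> N" for m
        using c0_apply_le_norm[of "X n - X m" i] N that \<open>n \<ge> N\<close> by fastforce
      then show "\<exists>M. \<forall>m\<ge>M. \<bar>c0_apply (X n) i - c0_apply (X m) i\<bar> \<le> e"
        by blast
    qed
    then show ?thesis by blast
  qed
  have "c0_fun L"
    unfolding c0_fun_def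
  proof (intro allI impI)
    fix e :: real
    assume e: "e > 0"
    then obtain N where N: "\<And>i. \<bar>c0_apply (X N) i - L i\<bar> \<le> e / 2"
      using unif[of "e / 2"] by auto
    have "\<bar>c0_apply (X N) i\<bar> \<ge> e / 2" if "\<bar>L i\<bar> \<ge> e" for i
      using N[of i] that by linarith
    then have "{i. \<bar>L i\<bar> \<ge> e} \<subseteq> {i. \<bar>c0_apply (X N) i\<bar> \<ge> e / 2}"
      by blast
    moreover have "finite {i. \<bar>c0_apply (X N) i\<bar> \<ge> e / 2}"
      using c0_fun_apply[of "X N"] half_gt_zero[OF e] unfolding c0_fun_def by blast
    ultimately show "finite {i. \<bar>L i\<bar> \<ge> e}"
      by (rule finite_subset)
  qed
  then have apply_L: "c0_apply (Abs_c0 L) = L"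
    by (simp add: Abs_c0_inverse)
  have "X \<longlonglongrightarrow> Abs_c0 L"
  proof (rule LIMSEQ_I)
    fix e :: real
    assume e: "e > 0"
    then obtain N where N: "\<forall>n\<ge>N. \<forall>i. \<bar>c0_apply (X n) i - L i\<bar> \<le> e / 2"
      using unif[of "e / 2"] by auto
    have "norm (X n - Abs_c0 L) \<le> e / 2" if "n \<ge> N" for n
      by (rule c0_norm_le) (use N that in \<open>simp only: apply_L minus_c0.rep_eq\<close>)
    then show "\<exists>N. \<forall>n\<ge>N. norm (X n - Abs_c0 L) < e"
      using e by (intro exI[of _ N]) fastforce
  qed
  then show "convergent X"
    by (rule convergentI)
qed

definition isomorphism_onto_image ::
    "('a::real_normed_vector \<Rightarrow> 'b::real_normed_vector) \<Rightarrow> bool" where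
  "isomorphism_onto_image S \<longleftrightarrow>
     bounded_linear S \<and> (\<exists>T. homeomorphism UNIV (range S) S T)"

definition equivalent_to_c0_basis :: "('i \<Rightarrow> 'a::real_normed_vector) \<Rightarrow> bool" where
  "equivalent_to_c0_basis x \<longleftrightarrow>
     (\<exists>S :: 'i c0 \<Rightarrow> 'a. isomorphism_onto_image S \<and> (\<forall>i. S (c0_unit i) = x i))"

definition weak_star_null :: "('i \<Rightarrow> 'a::real_normed_vector \<Rightarrow>\<^sub>L real) \<Rightarrow> bool" where
  "weak_star_null \<phi> \<longleftrightarrow> (\<forall>x. c0_fun (\<lambda>i. blinfun_apply (\<phi> i) x))"

text \<open>The type arguments stand for the index set \<open>\<tau>\<close> and the space \<open>X\<close>.\<close>

definition contains_complemented_c0 ::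
    "'i itself \<Rightarrow> 'a::real_normed_vector itself \<Rightarrow> bool" where
  "contains_complemented_c0 _ _ \<longleftrightarrow>
     (\<exists>Y :: 'a set. subspace Y \<and> closed Y \<and>
        (\<exists>S :: 'i c0 \<Rightarrow> 'a. isomorphism_onto_image S \<and> range S = Y) \<and>
        (\<exists>P :: 'a \<Rightarrow> 'a. bounded_linear P \<and> P \<circ> P = P \<and> range P = Y))"

end

theory Submission
  imports Defs
begin

text \<open>
  All three conditions are reformulations of one: there are bounded linear maps
  \<open>S : c\<^sub>0(\<tau>) \<rightarrow> X\<close> and \<open>Q : X \<rightarrow> c\<^sub>0(\<tau>)\<close> with \<open>Q \<circ> S = id\<close> (\<open>factors_identity\<close> below).
  Such a pair yields the projection \<open>S \<circ> Q\<close> onto the copy \<open>range S\<close> of \<open>c\<^sub>0(\<tau>)\<close>, and the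
  biorthogonal system consisting of the vectors \<open>S e\<^sub>i\<close> and the coordinate functionals of
  \<open>Q\<close>; this is the passage to (1) and to (2). Conversely, a projection \<open>P\<close> onto the range of
  an isomorphic embedding \<open>S\<close> gives \<open>Q = S\<^sup>-\<^sup>1 \<circ> P\<close>, and a weak-star null family \<open>(x\<^sub>i\<^sup>*)\<close> gives
  the map \<open>x \<mapsto> (x\<^sub>i\<^sup>*(x))\<^sub>i\<close> into \<open>c\<^sub>0(\<tau>)\<close>, which is bounded by the uniform boundedness
  principle; it is left inverse to \<open>S\<close> in the biorthogonal case, because a functional on
  \<open>c\<^sub>0(\<tau>)\<close> is determined by its values at the unit vectors.

  The substance is (3) \<open>\<Longrightarrow>\<close> (2). After rescaling, \<open>x\<^sub>i\<^sup>*(x\<^sub>i) = 1\<close>, but the off-diagonal entries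
  of the matrix \<open>x\<^sub>i\<^sup>*(x\<^sub>j)\<close> are uncontrolled. Its rows are the values at the unit vectors of the
  functionals \<open>x\<^sub>i\<^sup>* \<circ> S\<close> on \<open>c\<^sub>0(\<tau>)\<close>, so they are bounded in \<open>\<ell>\<^sub>1\<close>, uniformly in \<open>i\<close>.
  Rosenthal's disjointification argument (\<open>rosenthal_disjointification\<close>) then selects
  \<open>\<tau>\<close> many indices for which the off-diagonal row sums are at most \<open>1/2\<close>. On the copy of
  \<open>c\<^sub>0(\<tau>)\<close> spanned by the selected vectors, the map given by the selected functionals differs
  from the identity by an operator of norm at most \<open>1/2\<close>, so it is invertible, and composing
  with its inverse gives the required left inverse.
\<close>

section \<open>Bounded operators between Banach spaces\<close>

text \<open>The Banach--Steinhaus theorem. By Baire's theorem, one of the closed sets on which all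
  \<open>\<phi> i\<close> are bounded by \<open>n\<close> contains a ball; by linearity a bound on one ball is a bound on
  the norms.\<close>

lemma uniform_boundedness:
  fixes \<phi> :: "'i \<Rightarrow> 'a::banach \<Rightarrow>\<^sub>L 'b::real_normed_vector"
  assumes pointwise: "\<And>x. \<exists>B. \<forall>i. norm (\<phi> i x) \<le> B"
  obtains M where "M \<ge> 0" "\<And>i. norm (\<phi> i) \<le> M"
proof -
  define V where "V = (\<lambda>n::nat. {x. \<forall>i. norm (\<phi> i x) \<le> real n})"
  have closed: "closed (V n)" for n
    unfolding V_def
    by (intro closed_Collect_all closed_Collect_le continuous_intros)
  have "x \<in> \<Union>(range V)" for x
  proof -
    obtain B where "\<forall>i. norm (\<phi> i x) \<le> B"
      using pointwise by blast
    moreover obtain n :: nat where "B \<le> real n"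
      using real_arch_simple by blast
    ultimately show ?thesis
      unfolding V_def using order_trans by blast
  qed
  then have cover: "\<Union>(range V) = UNIV" by blast
  have "\<exists>n. interior (V n) \<noteq> {}"
  proof (rule ccontr)
    assume "\<not> ?thesis"
    then have "euclidean interior_of \<Union>(range V) = {}"
      by (intro Baire_category_alt)
        (auto simp: completely_metrizable_space_euclidean closed interior_of_def interior_def)
    with cover show False by simp
  qed
  then obtain n a where "a \<in> interior (V n)" by blast
  then obtain r where r: "r > 0" "cball a r \<subseteq> V n"
    by (meson mem_interior_cball)
  have "norm (\<phi> i z) \<le> 2 * real n / r * norm z" for i z
  proof (cases "z = 0")
    case False
    define w where "w = (r / norm z) *\<^sub>R z"
    have "norm w = r"
      using False r by (simp add: w_def)
    then have "a + w \<in> V n" "a \<in> V n"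
      using r by (auto simp: dist_norm subset_iff)
    then have bounds: "norm (\<phi> i (a + w)) \<le> real n" "norm (\<phi> i a) \<le> real n"
      by (auto simp: V_def)
    have "\<phi> i w = \<phi> i (a + w) - \<phi> i a"
      by (simp add: blinfun.add_right)
    then have "norm (\<phi> i w) \<le> 2 * real n"
      using bounds norm_triangle_ineq4[of "\<phi> i (a + w)" "\<phi> i a"] by simp
    moreover have "norm (\<phi> i w) = r / norm z * norm (\<phi> i z)"
      using r by (simp add: w_def blinfun.scaleR_right)
    ultimately show ?thesis
      using False r by (simp add: field_simps)
  qed simp
  then have "norm (\<phi> i) \<le> 2 * real n / r" for i
    using r by (intro norm_blinfun_bound) auto
  then show ?thesis
    using r by (intro that[of "2 * real n / r"]) auto
qed

text \<open>Continuity of the inverse at \<open>0\<close>, made quantitative by rescaling \<open>u\<close> to norm \<open>1\<close>.\<close>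

lemma isomorphism_onto_image_bounded_below:
  assumes "isomorphism_onto_image S"
  obtains c where "c > 0" "\<And>u. c * norm u \<le> norm (S u)"
proof -
  interpret bounded_linear S
    using assms by (simp add: isomorphism_onto_image_def)
  obtain T where T: "homeomorphism UNIV (range S) S T"
    using assms by (auto simp: isomorphism_onto_image_def)
  then have cont: "continuous_on (range S) T" and TS: "\<And>u. T (S u) = u"
    by (auto simp: homeomorphism_def)
  have T0: "T 0 = 0"
    using TS[of 0] zero by simp
  have "0 \<in> range S"
    using zero by (metis rangeI)
  then obtain d where d: "d > 0" "\<And>y. y \<in> range S \<Longrightarrow> norm y < d \<Longrightarrow> norm (T y) < 1"
    using cont T0 unfolding continuous_on_iff
    by (metis dist_0_norm dist_commute zero_less_one)
  have "d * norm u \<le> norm (S u)" for u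
  proof (rule ccontr)
    assume less: "\<not> ?thesis"
    then have "u \<noteq> 0" by auto
    then have "norm (S (u /\<^sub>R norm u)) < d"
      using less by (simp add: scaleR field_simps)
    then have "norm (u /\<^sub>R norm u) < 1"
      using d(2) TS by (metis rangeI)
    then show False
      using \<open>u \<noteq> 0\<close> by simp
  qed
  with d(1) show ?thesis by (rule that)
qed

text \<open>An operator into the range of an embedding \<open>S\<close> factors through \<open>S\<close>. The factor \<open>Q\<close>
  is linear because \<open>S\<close> is injective. The case \<open>P = id\<close> is the boundedness of the inverse of an
  operator that is onto and bounded below.\<close>

lemma bounded_linear_lift:
  assumes S: "bounded_linear S" and c: "c > 0" "\<And>u. c * norm u \<le> norm (S u)"
    and P: "bounded_linear P" and SQ: "\<And>x. S (Q x) = P x"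
  shows "bounded_linear Q"
proof -
  interpret S: bounded_linear S by fact
  interpret P: bounded_linear P by fact
  have eqI: "u = v" if "S u = S v" for u v
  proof -
    have "c * norm (u - v) \<le> 0"
      using c(2)[of "u - v"] that by (simp add: S.diff)
    then show ?thesis
      using c(1) by (simp add: mult_le_0_iff)
  qed
  obtain K where K: "\<And>x. norm (P x) \<le> norm x * K"
    using P.bounded by blast
  show ?thesis
  proof (rule bounded_linear_intro)
    show "Q (x + y) = Q x + Q y" for x y
      by (rule eqI) (simp add: S.add P.add SQ)
    show "Q (r *\<^sub>R x) = r *\<^sub>R Q x" for r x
      by (rule eqI) (simp add: S.scaleR P.scaleR SQ)
    show "norm (Q x) \<le> norm x * (K / c)" for x
      using c(1) c(2)[of "Q x"] K[of x] by (simp add: SQ field_simps)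
  qed
qed

text \<open>Solving \<open>A u = v\<close> means finding a fixed point of \<open>u \<mapsto> v + (u - A u)\<close>, which is a
  contraction.\<close>

lemma near_identity_invertible:
  fixes A :: "'b::banach \<Rightarrow> 'b"
  assumes A: "bounded_linear A" and near: "\<And>u. norm (u - A u) \<le> norm u / 2"
  obtains B where "bounded_linear B" "\<And>u. B (A u) = u"
proof -
  interpret bounded_linear A by fact
  have "\<exists>!u. v + (u - A u) = u" for v
  proof (rule banach_fix_type[where c = "1/2"])
    show "\<forall>x y. dist (v + (x - A x)) (v + (y - A y)) \<le> 1/2 * dist x y"
    proof (intro allI)
      fix x y
      have "norm ((v + (x - A x)) - (v + (y - A y))) = norm ((x - y) - A (x - y))"
        by (simp add: diff algebra_simps)
      then show "dist (v + (x - A x)) (v + (y - A y)) \<le> 1/2 * dist x y"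
        using near[of "x - y"] unfolding dist_norm by simp
    qed
  qed auto
  moreover have "v + (u - A u) = u \<longleftrightarrow> A u = v" for u v
    by (auto simp: algebra_simps)
  ultimately have ex1: "\<exists>!u. A u = v" for v
    by simp
  define B where "B = (\<lambda>v. THE u. A u = v)"
  have AB: "A (B v) = v" for v
    unfolding B_def by (rule theI'[OF ex1])
  have BA: "B (A u) = u" for u
    using ex1[of "A u"] AB[of "A u"] by blast
  have below: "1/2 * norm u \<le> norm (A u)" for u
    using near[of u] norm_triangle_ineq2[of u "u - A u"] by simp
  have "bounded_linear B"
    by (rule bounded_linear_lift[OF A _ below bounded_linear_ident AB]) simp
  with BA show ?thesis by (intro that)
qed

section \<open>Functionals and operators on \<open>c\<^sub>0\<close>\<close>

lemma c0_apply_sum: "c0_apply (sum g F) j = (\<Sum>i\<in>F. c0_apply (g i) j)"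
  by (induction F rule: infinite_finite_induct) auto

lemma bounded_linear_c0_apply: "bounded_linear (\<lambda>u. c0_apply u i)"
  by (rule bounded_linear_intro[where K = 1]) (auto intro: c0_apply_le_norm)

lemma c0_unit_expansion:
  assumes "finite F"
  shows "c0_apply (\<Sum>i\<in>F. g i *\<^sub>R c0_unit i) j = (if j \<in> F then g j else 0)"
  using assms by (simp add: c0_apply_sum if_distrib cong: if_cong)

text \<open>The dual of \<open>c\<^sub>0\<close> is \<open>\<ell>\<^sub>1\<close>: the next two lemmas are the two inequalities between the norm
  of a functional and the \<open>\<ell>\<^sub>1\<close>-norm of its values at the unit vectors. The first one tests the
  functional against a finite sum of signed unit vectors; the second one uses that the
  finitely supported elements are dense.\<close>

lemma c0_functional_l1_le:
  assumes \<phi>: "bounded_linear \<phi>" and K: "\<And>u. \<bar>\<phi> u\<bar> \<le> K * norm u" and F: "finite F"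
  shows "(\<Sum>j\<in>F. \<bar>\<phi> (c0_unit j)\<bar>) \<le> K"
proof -
  interpret bounded_linear \<phi> by fact
  define u where "u = (\<Sum>j\<in>F. sgn (\<phi> (c0_unit j)) *\<^sub>R c0_unit j)"
  have "K \<ge> 0"
    using K[of "c0_unit undefined"] c0_apply_le_norm[of "c0_unit undefined" undefined]
    by (smt (verit) c0_unit.rep_eq mult_neg_pos)
  have "\<bar>c0_apply u j\<bar> \<le> 1" for j
    unfolding u_def c0_unit_expansion[OF F] by (auto simp: sgn_if)
  then have "norm u \<le> 1" by (rule c0_norm_le)
  have "(\<Sum>j\<in>F. \<bar>\<phi> (c0_unit j)\<bar>) = \<phi> u"
    by (simp add: u_def sum scaleR abs_sgn mult.commute)
  also have "\<dots> \<le> K * norm u"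
    using K[of u] by simp
  also have "\<dots> \<le> K"
    using \<open>norm u \<le> 1\<close> \<open>K \<ge> 0\<close> by (simp add: mult_left_le)
  finally show ?thesis .
qed

lemma c0_functional_le_l1:
  assumes \<phi>: "bounded_linear \<phi>" and B: "\<And>F. finite F \<Longrightarrow> (\<Sum>j\<in>F. \<bar>\<phi> (c0_unit j)\<bar>) \<le> B"
  shows "\<bar>\<phi> u\<bar> \<le> B * norm u"
proof -
  interpret bounded_linear \<phi> by fact
  obtain K where K: "K > 0" "\<And>u. norm (\<phi> u) \<le> norm u * K"
    using pos_bounded by blast
  show ?thesis
  proof (rule field_le_epsilon)
    fix e :: real
    assume e: "e > 0"
    define F where "F = {i. \<bar>c0_apply u i\<bar> \<ge> e / K}"
    have F: "finite F"
      using c0_fun_apply[of u] K e by (auto simp: F_def c0_fun_def)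
    define v where "v = (\<Sum>j\<in>F. c0_apply u j *\<^sub>R c0_unit j)"
    have "norm (u - v) \<le> e / K"
    proof (rule c0_norm_le)
      fix i
      have "c0_apply (u - v) i = (if i \<in> F then 0 else c0_apply u i)"
        by (simp add: v_def c0_unit_expansion[OF F])
      then show "\<bar>c0_apply (u - v) i\<bar> \<le> e / K"
        using e K(1) by (auto simp: F_def)
    qed
    then have tail: "norm (\<phi> (u - v)) \<le> e"
      using K(2)[of "u - v"] K(1) by (simp add: field_simps)
    have "\<bar>\<phi> v\<bar> \<le> (\<Sum>j\<in>F. \<bar>c0_apply u j * \<phi> (c0_unit j)\<bar>)"
      by (simp add: v_def sum scaleR sum_abs)
    also have "\<dots> \<le> (\<Sum>j\<in>F. norm u * \<bar>\<phi> (c0_unit j)\<bar>)"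
      by (intro sum_mono) (simp add: abs_mult mult_right_mono c0_apply_le_norm)
    also have "\<dots> \<le> norm u * B"
      unfolding sum_distrib_left[symmetric] by (intro mult_left_mono B F) simp
    finally show "\<bar>\<phi> u\<bar> \<le> B * norm u + e"
      using tail by (simp add: diff mult.commute)
  qed
qed

lemma c0_operator_eq_id:
  assumes A: "bounded_linear A" and unit: "\<And>j. A (c0_unit j) = c0_unit j"
  shows "A u = u"
proof (rule c0_eqI)
  fix i
  have "bounded_linear (\<lambda>u. c0_apply (A u) i - c0_apply u i)"
    by (intro bounded_linear_sub bounded_linear_c0_apply
          bounded_linear_compose[OF bounded_linear_c0_apply A])
  from c0_functional_le_l1[OF this, of 0 u] show "c0_apply (A u) i = c0_apply u i"
    by (simp add: unit)
qed

text \<open>An injection of index sets induces an embedding of the corresponding spaces, by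
  extension by zero.\<close>

lemma c0_reindex:
  fixes f :: "'j \<Rightarrow> 'i"
  assumes f: "inj f"
  obtains E :: "'j c0 \<Rightarrow> 'i c0" where "bounded_linear E" "\<And>j. E (c0_unit j) = c0_unit (f j)"
proof -
  define g where "g = (\<lambda>(u :: 'j c0) k. if k \<in> range f then c0_apply u (inv f k) else 0)"
  define E where "E = (\<lambda>u. Abs_c0 (g u))"
  have "c0_fun (g u)" for u
    unfolding c0_fun_def
  proof (intro allI impI)
    fix e :: real
    assume "e > 0"
    then have "{k. \<bar>g u k\<bar> \<ge> e} \<subseteq> f ` {j. \<bar>c0_apply u j\<bar> \<ge> e}"
      by (auto simp: g_def f split: if_splits)
    moreover have "finite {j. \<bar>c0_apply u j\<bar> \<ge> e}"
      using c0_fun_apply[of u] \<open>e > 0\<close> by (simp add: c0_fun_def)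
    ultimately show "finite {k. \<bar>g u k\<bar> \<ge> e}"
      using finite_subset by blast
  qed
  then have E: "c0_apply (E u) = g u" for u
    by (simp add: E_def Abs_c0_inverse)
  show ?thesis
  proof
    show "bounded_linear E"
    proof (rule bounded_linear_intro[where K = 1])
      show "norm (E u) \<le> norm u * 1" for u
        by (auto intro!: c0_norm_le c0_apply_le_norm simp: E g_def)
    qed (auto intro!: c0_eqI simp: E g_def)
    show "E (c0_unit j) = c0_unit (f j)" for j
      by (rule c0_eqI) (auto simp: E g_def f inv_f_eq)
  qed
qed

section \<open>Weak-star null families as operators into \<open>c\<^sub>0\<close>\<close>

lemma weak_star_null_norm_bounded:
  fixes \<phi> :: "'i \<Rightarrow> 'a::banach \<Rightarrow>\<^sub>L real"
  assumes "weak_star_null \<phi>"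
  obtains M where "M \<ge> 0" "\<And>i. norm (\<phi> i) \<le> M"
proof -
  have "\<exists>B. \<forall>i. norm (\<phi> i x) \<le> B" for x
  proof -
    have "bdd_above (range (\<lambda>i. \<bar>\<phi> i x\<bar>))"
      using assms by (intro c0_fun_bdd_above) (simp add: weak_star_null_def)
    then show ?thesis
      by (auto simp: bdd_above_def)
  qed
  then show ?thesis
    using that by (rule uniform_boundedness)
qed

lemma weak_star_null_operator:
  fixes \<phi> :: "'i \<Rightarrow> 'a::banach \<Rightarrow>\<^sub>L real"
  assumes \<phi>: "weak_star_null \<phi>"
  obtains \<Phi> :: "'a \<Rightarrow> 'i c0"
    where "bounded_linear \<Phi>" "\<And>x i. c0_apply (\<Phi> x) i = \<phi> i x"
proof -
  define \<Phi> where "\<Phi> = (\<lambda>x. Abs_c0 (\<lambda>i. \<phi> i x))"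
  have \<Phi>: "c0_apply (\<Phi> x) i = \<phi> i x" for x i
    using \<phi> by (simp add: \<Phi>_def Abs_c0_inverse weak_star_null_def)
  obtain M where M: "M \<ge> 0" "\<And>i. norm (\<phi> i) \<le> M"
    using weak_star_null_norm_bounded[OF \<phi>] by blast
  have "bounded_linear \<Phi>"
  proof (rule bounded_linear_intro)
    show "norm (\<Phi> x) \<le> norm x * M" for x
    proof (rule c0_norm_le)
      fix i
      have "\<bar>\<phi> i x\<bar> \<le> norm (\<phi> i) * norm x"
        using norm_blinfun[of "\<phi> i" x] by simp
      also have "\<dots> \<le> norm x * M"
        unfolding mult.commute[of "norm x"] by (intro mult_right_mono M(2)) simp
      finally show "\<bar>c0_apply (\<Phi> x) i\<bar> \<le> norm x * M"
        by (simp add: \<Phi>)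
    qed
  qed (auto intro!: c0_eqI simp: \<Phi> blinfun.add_right blinfun.scaleR_right)
  with \<Phi> show ?thesis by (intro that)
qed

section \<open>Factoring the identity of \<open>c\<^sub>0\<close>\<close>

definition factors_identity :: "('i c0 \<Rightarrow> 'a::real_normed_vector) \<Rightarrow> ('a \<Rightarrow> 'i c0) \<Rightarrow> bool" where
  "factors_identity S Q \<longleftrightarrow> bounded_linear S \<and> bounded_linear Q \<and> (\<forall>u. Q (S u) = u)"

lemma factors_identity_isomorphism:
  assumes "factors_identity S Q"
  shows "isomorphism_onto_image S"
  unfolding isomorphism_onto_image_def
proof (intro conjI exI)
  have "bounded_linear S" "bounded_linear Q" and QS: "\<And>u. Q (S u) = u"
    using assms by (auto simp: factors_identity_def)
  then show "homeomorphism UNIV (range S) S Q"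
    by (intro homeomorphismI) (auto intro: linear_continuous_on)
qed (use assms in \<open>simp add: factors_identity_def\<close>)

lemma complemented_c0_iff:
  "contains_complemented_c0 TYPE('i) TYPE('a::real_normed_vector) \<longleftrightarrow>
     (\<exists>(S :: 'i c0 \<Rightarrow> 'a) Q. factors_identity S Q)"
proof
  assume "contains_complemented_c0 TYPE('i) TYPE('a)"
  then obtain S :: "'i c0 \<Rightarrow> 'a" and P where S: "isomorphism_onto_image S"
    and P: "bounded_linear P" "P \<circ> P = P" "range P = range S"
    unfolding contains_complemented_c0_def by metis
  then have bl: "bounded_linear S"
    by (simp add: isomorphism_onto_image_def)
  obtain c where c: "c > 0" "\<And>u. c * norm u \<le> norm (S u)"
    using isomorphism_onto_image_bounded_below[OF S] by blast
  have "inj S"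
    using S by (auto simp: isomorphism_onto_image_def homeomorphism_def intro: inj_on_inverseI)
  define Q where "Q = (\<lambda>x. inv S (P x))"
  have SQ: "S (Q x) = P x" for x
    unfolding Q_def by (rule f_inv_into_f) (use P(3) in auto)
  have "P (S u) = S u" for u
    using P(2,3) by (metis comp_apply imageE rangeI)
  then have "Q (S u) = u" for u
    by (simp add: Q_def \<open>inj S\<close>)
  moreover have "bounded_linear Q"
    by (rule bounded_linear_lift[OF bl c P(1) SQ])
  ultimately show "\<exists>(S :: 'i c0 \<Rightarrow> 'a) Q. factors_identity S Q"
    using bl by (auto simp: factors_identity_def)
next
  assume "\<exists>(S :: 'i c0 \<Rightarrow> 'a) Q. factors_identity S Q"
  then obtain S :: "'i c0 \<Rightarrow> 'a" and Q where SQ: "factors_identity S Q" by blast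
  then have S: "bounded_linear S" and Q: "bounded_linear Q" and QS: "\<And>u. Q (S u) = u"
    by (auto simp: factors_identity_def)
  have P: "bounded_linear (\<lambda>x. S (Q x))"
    by (rule bounded_linear_compose[OF S Q])
  have fixed: "range S = {x. S (Q x) = x}"
    using QS by (auto intro: range_eqI[OF sym])
  show "contains_complemented_c0 TYPE('i) TYPE('a)"
    unfolding contains_complemented_c0_def
  proof (intro exI[of _ "range S"] conjI)
    show "subspace (range S)"
      by (intro linear_subspace_image bounded_linear.linear[OF S] subspace_UNIV)
    show "closed (range S)"
      unfolding fixed
      by (intro closed_Collect_eq continuous_on_id linear_continuous_on[OF P])
    show "\<exists>S' :: 'i c0 \<Rightarrow> 'a. isomorphism_onto_image S' \<and> range S' = range S"
      using factors_identity_isomorphism[OF SQ] by blast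
    show "\<exists>P. bounded_linear P \<and> P \<circ> P = P \<and> range P = range S"
    proof (intro exI conjI)
      show "range (\<lambda>x. S (Q x)) = range S"
        using QS by (auto intro: range_eqI[where x = "S _"])
    qed (use P QS in auto)
  qed
qed

lemma biorthogonal_iff:
  "(\<exists>(x :: 'i \<Rightarrow> 'a::banach) x'. equivalent_to_c0_basis x \<and> weak_star_null x' \<and>
       (\<forall>i j. blinfun_apply (x' i) (x j) = (if i = j then 1 else 0))) \<longleftrightarrow>
     (\<exists>(S :: 'i c0 \<Rightarrow> 'a) Q. factors_identity S Q)"
  (is "?biorthogonal \<longleftrightarrow> ?factors")
proof
  assume ?biorthogonal
  then obtain x :: "'i \<Rightarrow> 'a" and x' where x: "equivalent_to_c0_basis x"
    and x': "weak_star_null x'"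
    and biorth: "\<And>i j. blinfun_apply (x' i) (x j) = (if i = j then 1 else 0)"
    by blast
  obtain S :: "'i c0 \<Rightarrow> 'a" where S: "bounded_linear S" "\<And>i. S (c0_unit i) = x i"
    using x by (auto simp: equivalent_to_c0_basis_def isomorphism_onto_image_def)
  obtain Q :: "'a \<Rightarrow> 'i c0" where Q: "bounded_linear Q"
    and coord: "\<And>y i. c0_apply (Q y) i = x' i y"
    using weak_star_null_operator[OF x'] by blast
  have "Q (S (c0_unit j)) = c0_unit j" for j
    by (rule c0_eqI) (simp add: coord S biorth)
  then have "Q (S u) = u" for u
    using c0_operator_eq_id[OF bounded_linear_compose[OF Q S(1)]] by blast
  then show ?factors
    using S Q by (auto simp: factors_identity_def)
next
  assume ?factors
  then obtain S :: "'i c0 \<Rightarrow> 'a" and Q where SQ: "factors_identity S Q" by blast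
  then have Q: "bounded_linear Q" and QS: "\<And>u. Q (S u) = u"
    by (auto simp: factors_identity_def)
  define x' where "x' = (\<lambda>i. Blinfun (\<lambda>y. c0_apply (Q y) i))"
  have x': "blinfun_apply (x' i) y = c0_apply (Q y) i" for i y
    unfolding x'_def
    by (subst bounded_linear_Blinfun_apply)
      (auto intro: bounded_linear_compose[OF bounded_linear_c0_apply Q])
  have "equivalent_to_c0_basis (\<lambda>i. S (c0_unit i))"
    using factors_identity_isomorphism[OF SQ] by (auto simp: equivalent_to_c0_basis_def)
  moreover have "weak_star_null x'"
    by (simp add: weak_star_null_def x' c0_fun_apply)
  ultimately show ?biorthogonal
    by (intro exI[of _ "\<lambda>i. S (c0_unit i)"] exI[of _ x']) (auto simp: x' QS)
qed

section \<open>Disjointification\<close>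

text \<open>Split the index set into \<open>\<tau>\<close> many blocks of size \<open>\<tau>\<close>. If some block has small
  off-diagonal row sums inside itself, it is the selection sought. Otherwise each block
  contains a row whose off-diagonal mass inside the block exceeds \<open>\<epsilon>\<close>. One such row per block
  makes \<open>\<tau>\<close> many indices, and this selection meets each block only once, so each
  selected row loses that mass when it is restricted to the selection: the bound on its
  off-diagonal sum drops from \<open>(n + 1)\<epsilon>\<close> to \<open>n\<epsilon>\<close>. This can be repeated only finitely often.
  The selection is encoded by an injection \<open>f\<close> of the index set into itself, which makes its
  cardinality \<open>\<tau>\<close>.\<close>

lemma rosenthal_disjointification:
  fixes a :: "'i \<Rightarrow> 'i \<Rightarrow> real"
  assumes inf: "infinite (UNIV :: 'i set)" and \<epsilon>: "\<epsilon> > 0"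
    and "\<And>i F. finite F \<Longrightarrow> i \<notin> F \<Longrightarrow> (\<Sum>j\<in>F. \<bar>a i j\<bar>) \<le> real n * \<epsilon>"
  shows "\<exists>f :: 'i \<Rightarrow> 'i. inj f \<and> (\<forall>i F. finite F \<longrightarrow> i \<notin> F \<longrightarrow> (\<Sum>j\<in>F. \<bar>a (f i) (f j)\<bar>) \<le> \<epsilon>)"
  using assms(3)
proof (induction n arbitrary: a)
  case 0
  have "(\<Sum>j\<in>F. \<bar>a i j\<bar>) \<le> \<epsilon>" if "finite F" "i \<notin> F" for i F
    using 0[OF that] \<epsilon> by simp
  then show ?case
    by (intro exI[of _ id]) simp
next
  case (Suc n)
  obtain h :: "'i \<times> 'i \<Rightarrow> 'i" where "bij_betw h (UNIV \<times> UNIV) UNIV"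
    using card_of_Times_same_infinite[OF inf] unfolding card_of_ordIso[symmetric] by auto
  then have h: "h p = h q \<longleftrightarrow> p = q" for p q
    by (simp add: bij_betw_def inj_eq)
  \<comment> \<open>The blocks are the sets of all \<open>h (k, l)\<close> with fixed \<open>k\<close>.\<close>
  show ?case
  proof (cases "\<exists>k. \<forall>i F. finite F \<longrightarrow> i \<notin> F \<longrightarrow> (\<Sum>j\<in>F. \<bar>a (h (k, i)) (h (k, j))\<bar>) \<le> \<epsilon>")
    case True
    then obtain k where
      "\<forall>i F. finite F \<longrightarrow> i \<notin> F \<longrightarrow> (\<Sum>j\<in>F. \<bar>a (h (k, i)) (h (k, j))\<bar>) \<le> \<epsilon>" ..
    moreover have "inj (\<lambda>i. h (k, i))"
      by (simp add: inj_def h)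
    ultimately show ?thesis
      by (intro exI[of _ "\<lambda>i. h (k, i)"] conjI)
  next
    case False
    then have "\<forall>k. \<exists>i F. finite F \<and> i \<notin> F \<and> (\<Sum>j\<in>F. \<bar>a (h (k, i)) (h (k, j))\<bar>) > \<epsilon>"
      by (simp add: not_le)
    then obtain r G where G: "\<And>k. finite (G k)" "\<And>k. r k \<notin> G k"
      and large: "\<And>k. (\<Sum>j\<in>G k. \<bar>a (h (k, r k)) (h (k, j))\<bar>) > \<epsilon>"
      by metis
    define g where "g = (\<lambda>k. h (k, r k))"
    have g: "inj g"
      by (simp add: g_def inj_def h)
    have "(\<Sum>j\<in>F. \<bar>a (g i) (g j)\<bar>) \<le> real n * \<epsilon>" if F: "finite F" "i \<notin> F" for i F
    proof -
      let ?G = "(\<lambda>j. h (i, j)) ` G i"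
      have inj_block: "inj_on (\<lambda>j. h (i, j)) (G i)"
        by (simp add: inj_on_def h)
      have disjoint: "g ` F \<inter> ?G = {}"
        using F by (auto simp: g_def h)
      have "g i \<notin> g ` F \<union> ?G"
        using F G by (auto simp: g_def h)
      then have "(\<Sum>j\<in>g ` F \<union> ?G. \<bar>a (g i) j\<bar>) \<le> real (Suc n) * \<epsilon>"
        using F G by (intro Suc.prems) auto
      moreover have "(\<Sum>j\<in>g ` F \<union> ?G. \<bar>a (g i) j\<bar>) =
          (\<Sum>j\<in>g ` F. \<bar>a (g i) j\<bar>) + (\<Sum>j\<in>?G. \<bar>a (g i) j\<bar>)"
        using F G disjoint by (intro sum.union_disjoint) auto
      moreover have "(\<Sum>j\<in>g ` F. \<bar>a (g i) j\<bar>) = (\<Sum>j\<in>F. \<bar>a (g i) (g j)\<bar>)"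
        using g by (simp add: sum.reindex inj_on_subset)
      moreover have "(\<Sum>j\<in>?G. \<bar>a (g i) j\<bar>) = (\<Sum>j\<in>G i. \<bar>a (g i) (h (i, j))\<bar>)"
        using inj_block by (simp add: sum.reindex)
      ultimately show ?thesis
        using large[of i] by (simp add: g_def algebra_simps)
    qed
    from Suc.IH[OF this] obtain f :: "'i \<Rightarrow> 'i" where "inj f \<and>
        (\<forall>i F. finite F \<longrightarrow> i \<notin> F \<longrightarrow> (\<Sum>j\<in>F. \<bar>a (g (f i)) (g (f j))\<bar>) \<le> \<epsilon>)" ..
    then show ?thesis
      using inj_compose[OF g, of f] by (intro exI[of _ "g \<circ> f"]) (simp add: o_def)
  qed
qed

section \<open>From diagonally bounded families to biorthogonal ones\<close>

lemma weak_star_null_rescale_reindex: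
  fixes \<phi> :: "'i \<Rightarrow> 'a::real_normed_vector \<Rightarrow>\<^sub>L real" and f :: "'j \<Rightarrow> 'i"
  assumes \<phi>: "weak_star_null \<phi>" and C: "\<And>i. \<bar>c i\<bar> \<le> C" and f: "inj f"
  shows "weak_star_null (\<lambda>j. c (f j) *\<^sub>R \<phi> (f j))"
  unfolding weak_star_null_def c0_fun_def
proof (intro allI impI)
  fix x and e :: real
  assume e: "e > 0"
  \<comment> \<open>As \<open>C\<close> may be \<open>0\<close>, the threshold is divided by the larger bound \<open>\<bar>C\<bar> + 1\<close> instead.\<close>
  let ?I = "{i. \<bar>\<phi> i x\<bar> \<ge> e / (\<bar>C\<bar> + 1)}"
  have "finite ?I"
    using \<phi> e by (simp add: weak_star_null_def c0_fun_def)
  then have "finite (f -` ?I)"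
    using f by (rule finite_vimageI)
  moreover have "{j. \<bar>(c (f j) *\<^sub>R \<phi> (f j)) x\<bar> \<ge> e} \<subseteq> f -` ?I"
  proof
    fix j
    assume "j \<in> {j. \<bar>(c (f j) *\<^sub>R \<phi> (f j)) x\<bar> \<ge> e}"
    then have "e \<le> \<bar>(c (f j) *\<^sub>R \<phi> (f j)) x\<bar>"
      by simp
    also have "\<dots> = \<bar>c (f j)\<bar> * \<bar>\<phi> (f j) x\<bar>"
      by (simp add: blinfun.scaleR_left abs_mult)
    also have "\<dots> \<le> (\<bar>C\<bar> + 1) * \<bar>\<phi> (f j) x\<bar>"
      using C[of "f j"] by (intro mult_right_mono) auto
    finally show "j \<in> f -` ?I"
      by (simp add: field_simps)
  qed
  ultimately show "finite {j. \<bar>(c (f j) *\<^sub>R \<phi> (f j)) x\<bar> \<ge> e}"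
    using finite_subset by blast
qed

text \<open>The operator \<open>A\<close> of the proof has the matrix \<open>x\<^sub>i\<^sup>*(x\<^sub>j)\<close> of the rescaled family, restricted
  to the selected indices. Its diagonal is \<open>1\<close> and its off-diagonal row sums are at most
  \<open>1/2\<close>, so it is close to the identity, and its inverse corrects the coordinate map
  \<open>\<Phi>\<close> to a left inverse.\<close>

lemma diagonally_bounded_imp_factors_identity:
  fixes x :: "'i \<Rightarrow> 'a::banach" and x' :: "'i \<Rightarrow> 'a \<Rightarrow>\<^sub>L real"
  assumes inf: "infinite (UNIV :: 'i set)"
    and x: "equivalent_to_c0_basis x" and x': "weak_star_null x'"
    and pos: "(INF i. \<bar>x' i (x i)\<bar>) > 0"
  shows "\<exists>(S :: 'i c0 \<Rightarrow> 'a) Q. factors_identity S Q"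
proof -
  define \<delta> where "\<delta> = (INF i. \<bar>x' i (x i)\<bar>)"
  have \<delta>: "\<delta> > 0" "\<And>i. \<delta> \<le> \<bar>x' i (x i)\<bar>"
    using pos by (auto simp: \<delta>_def intro!: cINF_lower bdd_belowI[of _ 0])
  then have nz: "x' i (x i) \<noteq> 0" for i
    by (metis abs_zero not_le)
  define y where "y = (\<lambda>i. inverse (x' i (x i)) *\<^sub>R x' i)"
  have y_diag: "y i (x i) = 1" for i
    using nz by (simp add: y_def blinfun.scaleR_left)
  have scalars: "\<bar>inverse (x' i (x i))\<bar> \<le> inverse \<delta>" for i
    using \<delta> by (simp add: le_imp_inverse_le)
  have y_null: "weak_star_null (\<lambda>j. y (f j))" if "inj f" for f :: "'i \<Rightarrow> 'i"
    unfolding y_def by (rule weak_star_null_rescale_reindex[OF x' scalars that])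

  obtain S :: "'i c0 \<Rightarrow> 'a" where S: "bounded_linear S" "\<And>i. S (c0_unit i) = x i"
    using x by (auto simp: equivalent_to_c0_basis_def isomorphism_onto_image_def)
  obtain M where M: "M \<ge> 0" "\<And>i. norm (y i) \<le> M"
    using weak_star_null_norm_bounded[OF y_null[of id]] by auto
  obtain K where K: "K > 0" "\<And>u. norm (S u) \<le> norm u * K"
    using bounded_linear.pos_bounded[OF S(1)] by blast
  have row_sums: "(\<Sum>j\<in>F. \<bar>y i (x j)\<bar>) \<le> M * K" if "finite F" for i F
  proof -
    have "bounded_linear (\<lambda>u. y i (S u))"
      by (rule bounded_linear_compose[OF blinfun.bounded_linear_right S(1)])
    moreover have "\<bar>y i (S u)\<bar> \<le> M * K * norm u" for u
    proof -
      have "\<bar>y i (S u)\<bar> \<le> norm (y i) * norm (S u)"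
        using norm_blinfun[of "y i" "S u"] by simp
      also have "\<dots> \<le> M * (norm u * K)"
        using M K by (intro mult_mono) auto
      finally show ?thesis by (simp add: mult_ac)
    qed
    ultimately have "(\<Sum>j\<in>F. \<bar>y i (S (c0_unit j))\<bar>) \<le> M * K"
      using that by (rule c0_functional_l1_le)
    then show ?thesis by (simp add: S)
  qed
  obtain n :: nat where "M * K * 2 \<le> real n"
    using real_arch_simple by blast
  then have "(\<Sum>j\<in>F. \<bar>y i (x j)\<bar>) \<le> real n * (1/2)" if "finite F" "i \<notin> F" for i F
    using row_sums[OF that(1), of i] by simp
  from rosenthal_disjointification[where a = "\<lambda>i j. y i (x j)" and \<epsilon> = "1/2",
      OF inf half_gt_zero[OF zero_less_one] this]
  obtain f :: "'i \<Rightarrow> 'i" where "inj f \<and>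
      (\<forall>i F. finite F \<longrightarrow> i \<notin> F \<longrightarrow> (\<Sum>j\<in>F. \<bar>y (f i) (x (f j))\<bar>) \<le> 1/2)" ..
  then have f: "inj f"
    and off_diag: "\<And>i F. finite F \<Longrightarrow> i \<notin> F \<Longrightarrow> (\<Sum>j\<in>F. \<bar>y (f i) (x (f j))\<bar>) \<le> 1/2"
    by simp_all

  obtain \<Phi> :: "'a \<Rightarrow> 'i c0" where \<Phi>: "bounded_linear \<Phi>"
    and coord: "\<And>z i. c0_apply (\<Phi> z) i = y (f i) z"
    using weak_star_null_operator[OF y_null[OF f]] by blast
  obtain E :: "'i c0 \<Rightarrow> 'i c0"
    where E: "bounded_linear E" "\<And>j. E (c0_unit j) = c0_unit (f j)"
    using c0_reindex[OF f] by blast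
  have SE: "bounded_linear (\<lambda>u. S (E u))"
    by (rule bounded_linear_compose[OF S(1) E(1)])
  define A where "A = (\<lambda>u. \<Phi> (S (E u)))"
  have A: "bounded_linear A"
    unfolding A_def by (rule bounded_linear_compose[OF \<Phi> SE])
  have A_unit: "c0_apply (A (c0_unit j)) i = y (f i) (x (f j))" for i j
    by (simp add: A_def coord E S)
  have "norm (u - A u) \<le> norm u / 2" for u
  proof (rule c0_norm_le)
    fix i
    define \<phi> where "\<phi> = (\<lambda>u. c0_apply u i - c0_apply (A u) i)"
    have "bounded_linear \<phi>"
      unfolding \<phi>_def
      by (intro bounded_linear_sub bounded_linear_c0_apply
            bounded_linear_compose[OF bounded_linear_c0_apply A])
    moreover have "(\<Sum>j\<in>F. \<bar>\<phi> (c0_unit j)\<bar>) \<le> 1/2" if "finite F" for F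
    proof -
      have "(\<Sum>j\<in>F. \<bar>\<phi> (c0_unit j)\<bar>) = (\<Sum>j\<in>F - {i}. \<bar>\<phi> (c0_unit j)\<bar>)"
        using that by (intro sum.mono_neutral_right) (auto simp: \<phi>_def A_unit y_diag)
      also have "\<dots> = (\<Sum>j\<in>F - {i}. \<bar>y (f i) (x (f j))\<bar>)"
        by (intro sum.cong) (auto simp: \<phi>_def A_unit)
      also have "\<dots> \<le> 1/2"
        using that by (intro off_diag) auto
      finally show ?thesis .
    qed
    ultimately have "\<bar>\<phi> u\<bar> \<le> 1/2 * norm u"
      by (rule c0_functional_le_l1)
    then show "\<bar>c0_apply (u - A u) i\<bar> \<le> norm u / 2"
      by (simp add: \<phi>_def)
  qed
  then obtain B where B: "bounded_linear B" "\<And>u. B (A u) = u"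
    using near_identity_invertible[OF A] by blast
  have "factors_identity (\<lambda>u. S (E u)) (\<lambda>z. B (\<Phi> z))"
    using SE bounded_linear_compose[OF B(1) \<Phi>] B(2) by (simp add: factors_identity_def A_def)
  then show ?thesis by blast
qed

theorem theorem2p4:
  assumes "infinite (UNIV :: 'i set)"
  shows "(contains_complemented_c0 TYPE('i) TYPE('a::banach) \<longleftrightarrow>
           (\<exists>(x :: 'i \<Rightarrow> 'a) (x' :: 'i \<Rightarrow> 'a \<Rightarrow>\<^sub>L real).
              equivalent_to_c0_basis x \<and> weak_star_null x' \<and>
              (\<forall>i j. blinfun_apply (x' i) (x j) = (if i = j then 1 else 0))))
       \<and> ((\<exists>(x :: 'i \<Rightarrow> 'a) (x' :: 'i \<Rightarrow> 'a \<Rightarrow>\<^sub>L real).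
              equivalent_to_c0_basis x \<and> weak_star_null x' \<and>
              (\<forall>i j. blinfun_apply (x' i) (x j) = (if i = j then 1 else 0))) \<longleftrightarrow>
           (\<exists>(x :: 'i \<Rightarrow> 'a) (x' :: 'i \<Rightarrow> 'a \<Rightarrow>\<^sub>L real).
              equivalent_to_c0_basis x \<and> weak_star_null x' \<and>
              (INF i. \<bar>blinfun_apply (x' i) (x i)\<bar>) > 0))"
proof -
  let ?biorthogonal = "\<exists>(x :: 'i \<Rightarrow> 'a) (x' :: 'i \<Rightarrow> 'a \<Rightarrow>\<^sub>L real).
    equivalent_to_c0_basis x \<and> weak_star_null x' \<and>
    (\<forall>i j. blinfun_apply (x' i) (x j) = (if i = j then 1 else 0))"
  let ?bounded = "\<exists>(x :: 'i \<Rightarrow> 'a) (x' :: 'i \<Rightarrow> 'a \<Rightarrow>\<^sub>L real).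
    equivalent_to_c0_basis x \<and> weak_star_null x' \<and>
    (INF i. \<bar>blinfun_apply (x' i) (x i)\<bar>) > 0"
  have "?biorthogonal \<Longrightarrow> ?bounded"
  proof -
    assume ?biorthogonal
    then obtain x :: "'i \<Rightarrow> 'a" and x' where "equivalent_to_c0_basis x" "weak_star_null x'"
      and biorth: "\<And>i j. blinfun_apply (x' i) (x j) = (if i = j then 1 else 0)"
      by blast
    moreover have "(INF i. \<bar>blinfun_apply (x' i) (x i)\<bar>) > 0"
      by (simp add: biorth)
    ultimately show ?bounded by blast
  qed
  moreover have "?bounded \<Longrightarrow> ?biorthogonal"
    unfolding biorthogonal_iff using diagonally_bounded_imp_factors_identity[OF assms] by blast
  ultimately show ?thesis
    unfolding complemented_c0_iff biorthogonal_iff by blast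
qed

end
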